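(* Let $A$ be a (finite or countably infinite) alphabet with $|A|>1$ and let $\mu$ be a probability distribution on $A$. Let $x^*=x_1x_2\dots$ be a sequence of i.i.d. random variables with distribution $\mu$ on $A$ (the covertext), and let $y^*=y_1y_2\dots$ be a sequence of i.i.d. random variables uniform on $\{0,1\}$ (the hidden text), independent of $x^*$. Let $X=X_1X_2\dots$ be the sequence output by the stegosystem $St_2(A)$ applied to $x^*$ and $y^*$. Then $X$ obeys the same distribution as the input sequence, i.e. $X_1,X_2,\dots$ are i.i.d. with distribution $\mu$, and the (expected) number of letters of hidden text transmitted per letter of covertext is $$\frac12\Bigl(1-\sum_{a\in A}\mu(a)^2\Bigr).$$
   Context: The stegosystem $St_2(A)$: fix a total ordering $<$ on $A$. The sequence $x^*$ is split into consecutive blocks of length two, $x_{2i-1}x_{2i}$, $i=1,2,\dots$, which are processed in order; a pointer to the current (first not yet used) symbol $y_k$ of $y^*$ is maintained, starting with $k=1$. If $x_{2i-1}=x_{2i}$, then the block is left unchanged, $X_{2i-1}X_{2i}=x_{2i-1}x_{2i}$, and no symbol of $y^*$ is used. If $x_{2i-1}\neq x_{2i}$, let $a<b$ be the two letters occurring in the block (in either order); if the current symbol $y_k$ is $0$ then $X_{2i-1}X_{2i}=ab$, and if $y_k=1$ then $X_{2i-1}X_{2i}=ba$; the symbol $y_k$ is then used up and $k$ is increased by one. The number of letters of hidden text transmitted per letter of covertext is the expected number of symbols of $y^*$ used up in the processing of one block of $x^*$, divided by the block length $2$. *)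

theory Defs
  imports "HOL-Probability.Probability" "HOL-Library.Z2"
begin

text \<open>All sequences are indexed from 0, so the block with index \<open>j\<close> of a sequence \<open>x\<close>
  consists of \<open>x (2 * j)\<close> and \<open>x (2 * j + 1)\<close>.\<close>

definition block :: "(nat \<Rightarrow> 'a) \<Rightarrow> nat \<Rightarrow> 'a \<times> 'a" where
  "block x j = (x (2 * j), x (2 * j + 1))"

fun st2_block :: "'a::linorder \<times> 'a \<Rightarrow> bit \<Rightarrow> 'a \<times> 'a" where
  "st2_block (u, v) s =
     (if u = v then (u, v)
      else let a = min u v; b = max u v in if s = 0 then (a, b) else (b, a))"

fun st2_used :: "'a \<times> 'a \<Rightarrow> nat" where
  "st2_used (u, v) = (if u = v then 0 else 1)"

text \<open>Position of the first unused symbol of the hidden text before block \<open>j\<close> is processed.\<close>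

primrec st2_pointer :: "(nat \<Rightarrow> 'a) \<Rightarrow> nat \<Rightarrow> nat" where
  "st2_pointer x 0 = 0"
| "st2_pointer x (Suc j) = st2_pointer x j + st2_used (block x j)"

definition St2 :: "(nat \<Rightarrow> 'a::linorder) \<Rightarrow> (nat \<Rightarrow> bit) \<Rightarrow> nat \<Rightarrow> 'a" where
  "St2 x y n =
     (let j = n div 2; B = st2_block (block x j) (y (st2_pointer x j))
      in if even n then fst B else snd B)"

definition iid_seq :: "'w measure \<Rightarrow> 'a pmf \<Rightarrow> (nat \<Rightarrow> 'w \<Rightarrow> 'a) \<Rightarrow> bool" where
  "iid_seq M p X \<longleftrightarrow>
     prob_space.indep_vars M (\<lambda>_. count_space UNIV) X UNIV \<and>
     (\<forall>n. distr M (count_space UNIV) (X n) = measure_pmf p)"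

text \<open>Independence of two random sequences as whole sequences. The library's \<open>indep_var\<close>
  requires both random variables to have the same value type, so its definition is
  restated here for two different types.\<close>

definition seq_sets :: "'w measure \<Rightarrow> (nat \<Rightarrow> 'w \<Rightarrow> 'a) \<Rightarrow> 'w set set" where
  "seq_sets M X =
     {(\<lambda>\<omega> n. X n \<omega>) -` S \<inter> space M | S. S \<in> sets (PiM UNIV (\<lambda>_::nat. count_space UNIV))}"

definition indep_seqs :: "'w measure \<Rightarrow> (nat \<Rightarrow> 'w \<Rightarrow> 'a) \<Rightarrow> (nat \<Rightarrow> 'w \<Rightarrow> 'b) \<Rightarrow> bool" where
  "indep_seqs M X Y \<longleftrightarrow> prob_space.indep_set M (seq_sets M X) (seq_sets M Y)"

text \<open>Expected number of hidden letters used up by block \<open>j\<close>, per letter of covertext.\<close>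

definition hidden_rate :: "'w measure \<Rightarrow> (nat \<Rightarrow> 'w \<Rightarrow> 'a) \<Rightarrow> nat \<Rightarrow> real" where
  "hidden_rate M x j = (\<integral>\<omega>. real (st2_used (block (\<lambda>n. x n \<omega>) j)) \<partial>M) / 2"

end

theory Submission
  imports Defs
begin

text \<open>An output block is a permutation of the input block, so the pointer into the hidden text is
  the same function of the output as of the covertext. Replace the covertext by the output one
  block at a time: if the output block \<open>ab\<close> has \<open>a \<noteq> b\<close>, the input block was \<open>ab\<close> or \<open>ba\<close>, of
  equal probability, and one hidden bit is prescribed, so the factors 2 and 1/2 cancel. Hence
  the output has the same finite-dimensional laws as the covertext.\<close>

section \<open>Combinatorics of the stegosystem\<close>

lemma all_less_double_Suc:
  "(\<forall>i<2 * Suc N. P i) \<longleftrightarrow> (\<forall>i<2 * N. P i) \<and> P (2 * N) \<and> P (2 * N + 1)"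
  by (auto simp: less_Suc_eq)

lemma all_from_double:
  assumes "N < L"
  shows "(\<forall>i<2 * L. 2 * N \<le> i \<longrightarrow> P i) \<longleftrightarrow>
    P (2 * N) \<and> P (2 * N + 1) \<and> (\<forall>i<2 * L. 2 * Suc N \<le> i \<longrightarrow> P i)"
proof (intro iffI conjI allI impI)
  fix i assume *: "P (2 * N) \<and> P (2 * N + 1) \<and> (\<forall>i<2 * L. 2 * Suc N \<le> i \<longrightarrow> P i)"
    "i < 2 * L" "2 * N \<le> i"
  then have "i = 2 * N \<or> i = 2 * N + 1 \<or> 2 * Suc N \<le> i" by auto
  then show "P i" using * by auto
qed (use assms in auto)

lemma all_from_Suc:
  fixes k K :: nat
  assumes "k < K"
  shows "(\<forall>i<K. k \<le> i \<longrightarrow> P i) \<longleftrightarrow> P k \<and> (\<forall>i<K. Suc k \<le> i \<longrightarrow> P i)"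
  using assms by (auto simp: Suc_le_eq nat_less_le)

text \<open>For distinct letters the output order records the hidden bit and forgets the input
  order, so each output block has two preimages and one prescribed bit.\<close>

lemma st2_block_eq_iff:
  "st2_block (u, v) s = (a, b) \<longleftrightarrow>
    (if a = b then (u, v) = (a, b)
     else ((u, v) = (a, b) \<or> (u, v) = (b, a)) \<and> s = (if a < b then 0 else 1))"
  by (cases s) (auto simp: Let_def min_def max_def)

lemma st2_used_st2_block: "st2_used (st2_block B s) = st2_used B"
  by (cases B) (auto simp: Let_def min_def max_def)

lemma block_St2: "block (St2 x y) j = st2_block (block x j) (y (st2_pointer x j))"
  by (simp add: block_def St2_def Let_def)

text \<open>Processing keeps whether the letters of a block are equal, and the pointer only counts
  blocks with distinct letters.\<close>

lemma st2_pointer_St2: "st2_pointer (St2 x y) N = st2_pointer x N"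
  by (induction N) (simp_all add: block_St2 st2_used_st2_block)

lemma st2_pointer_cong:
  "(\<And>i. i < 2 * N \<Longrightarrow> c i = d i) \<Longrightarrow> st2_pointer c N = st2_pointer d N"
  by (induction N) (auto simp: block_def)

text \<open>Once the output prefix is fixed to \<open>c\<close>, the pointer has the deterministic
  value \<open>st2_pointer c N\<close>, so inverting the block map constrains a hidden bit at a
  known position.\<close>

lemma St2_block_eq_iff:
  assumes "\<forall>i<2 * N. St2 x y i = c i"
  shows "St2 x y (2 * N) = c (2 * N) \<and> St2 x y (2 * N + 1) = c (2 * N + 1) \<longleftrightarrow>
    (if c (2 * N) = c (2 * N + 1) then x (2 * N) = c (2 * N) \<and> x (2 * N + 1) = c (2 * N + 1)
     else (x (2 * N) = c (2 * N) \<and> x (2 * N + 1) = c (2 * N + 1) \<or>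
         x (2 * N) = c (2 * N + 1) \<and> x (2 * N + 1) = c (2 * N)) \<and>
       y (st2_pointer c N) = (if c (2 * N) < c (2 * N + 1) then 0 else 1))"
proof -
  have "st2_pointer c N = st2_pointer x N"
    using st2_pointer_cong[of N "St2 x y" c] assms by (simp add: st2_pointer_St2)
  then have "(St2 x y (2 * N), St2 x y (2 * N + 1)) =
      st2_block (x (2 * N), x (2 * N + 1)) (y (st2_pointer c N))"
    using block_St2[of x y N] unfolding block_def by (simp only:)
  then have "St2 x y (2 * N) = c (2 * N) \<and> St2 x y (2 * N + 1) = c (2 * N + 1) \<longleftrightarrow>
      st2_block (x (2 * N), x (2 * N + 1)) (y (st2_pointer c N)) = (c (2 * N), c (2 * N + 1))"
    by (metis Pair_inject)
  then show ?thesis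
    unfolding st2_block_eq_iff prod.inject .
qed

text \<open>Interpolates between prescribing covertext and hidden text (\<open>N = 0\<close>) and prescribing the
  output (\<open>N = L\<close>). Hidden bits are constrained only from the pointer on.\<close>

definition st2_hybrid ::
  "(nat \<Rightarrow> 'a::linorder) \<Rightarrow> (nat \<Rightarrow> bit) \<Rightarrow> nat \<Rightarrow> nat \<Rightarrow> (nat \<Rightarrow> 'a) \<Rightarrow> (nat \<Rightarrow> bit) \<Rightarrow> nat \<Rightarrow> bool"
where
  "st2_hybrid x y L K c t N \<longleftrightarrow>
     (\<forall>i<2 * N. St2 x y i = c i) \<and> (\<forall>i<2 * L. 2 * N \<le> i \<longrightarrow> x i = c i) \<and>
     (\<forall>i<K. st2_pointer c N \<le> i \<longrightarrow> y i = t i)"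

text \<open>For distinct letters this gives the second preimage of output block
  \<open>N\<close>.\<close>

definition swap_block :: "nat \<Rightarrow> (nat \<Rightarrow> 'a) \<Rightarrow> nat \<Rightarrow> 'a" where
  "swap_block N c = c(2 * N := c (2 * N + 1), 2 * N + 1 := c (2 * N))"

lemma st2_pointer_swap_block: "st2_pointer (swap_block N c) N = st2_pointer c N"
  by (rule st2_pointer_cong) (simp add: swap_block_def)

text \<open>A block of equal letters passes unchanged and leaves the pointer in place, so
  prescribing its input or its output is the same constraint.\<close>

lemma st2_hybrid_Suc_eq:
  assumes "N < L" and "c (2 * N) = c (2 * N + 1)"
  shows "st2_hybrid x y L K c t (Suc N) \<longleftrightarrow> st2_hybrid x y L K c t N"
proof -
  have "st2_pointer c (Suc N) = st2_pointer c N"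
    using assms(2) by (simp add: block_def)
  then show ?thesis
    unfolding st2_hybrid_def all_less_double_Suc all_from_double[OF assms(1)]
    using St2_block_eq_iff[of N x y c] assms(2) by auto
qed

text \<open>The pointer moves past position \<open>st2_pointer c N\<close>, which releases that bit
  from \<open>t\<close>; the order of the output letters prescribes it instead, and
  \<open>t'\<close> stores the value. The two disjuncts are the two possible orders of the input
  block.\<close>

lemma st2_hybrid_Suc_neq:
  fixes t :: "nat \<Rightarrow> bit"
  assumes "N < L" and neq: "c (2 * N) \<noteq> c (2 * N + 1)" and K: "st2_pointer c (Suc N) \<le> K"
  defines "s \<equiv> if c (2 * N) < c (2 * N + 1) then 0 else 1"
  defines "t' \<equiv> t(st2_pointer c N := s)"
  shows "st2_hybrid x y L K c t (Suc N) \<longleftrightarrow>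
    st2_hybrid x y L K c t' N \<or> st2_hybrid x y L K (swap_block N c) t' N"
proof -
  define k where "k = st2_pointer c N"
  have k_Suc: "st2_pointer c (Suc N) = Suc k"
    using neq by (simp add: block_def k_def)
  \<comment> \<open>The bit used by block \<open>N\<close> lies in the constrained range, so it can
    be split off with \<open>all_from_Suc\<close>.\<close>
  then have k: "k < K" using K by simp
  have t': "(\<forall>i<K. Suc k \<le> i \<longrightarrow> y i = t' i) \<longleftrightarrow> (\<forall>i<K. Suc k \<le> i \<longrightarrow> y i = t i)" "t' k = s"
    by (auto simp: t'_def k_def)
  have swap: "(\<forall>i<2 * N. St2 x y i = swap_block N c i) \<longleftrightarrow> (\<forall>i<2 * N. St2 x y i = c i)"
    "(\<forall>i<2 * L. 2 * Suc N \<le> i \<longrightarrow> x i = swap_block N c i) \<longleftrightarrow>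
     (\<forall>i<2 * L. 2 * Suc N \<le> i \<longrightarrow> x i = c i)"
    "swap_block N c (2 * N) = c (2 * N + 1)" "swap_block N c (2 * N + 1) = c (2 * N)"
    by (auto simp: swap_block_def)
  have step: "(\<forall>i<2 * N. St2 x y i = c i) \<Longrightarrow>
      St2 x y (2 * N) = c (2 * N) \<and> St2 x y (2 * N + 1) = c (2 * N + 1) \<longleftrightarrow>
      (x (2 * N) = c (2 * N) \<and> x (2 * N + 1) = c (2 * N + 1) \<or>
       x (2 * N) = c (2 * N + 1) \<and> x (2 * N + 1) = c (2 * N)) \<and> y k = s"
    using St2_block_eq_iff[of N x y c] unfolding if_not_P[OF neq] k_def s_def .
  \<comment> \<open>The equivalence \<open>step\<close> is available only under the prefix condition
    \<open>P\<close>, which occurs on both sides here and can therefore serve as its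
    premise.\<close>
  have taut: "(P \<Longrightarrow> X1 \<and> X2 \<longleftrightarrow> (A1 \<and> A2 \<or> B1 \<and> B2) \<and> Y) \<Longrightarrow>
      (P \<and> X1 \<and> X2) \<and> D \<and> T \<longleftrightarrow>
      P \<and> (A1 \<and> A2 \<and> D) \<and> Y \<and> T \<or> P \<and> (B1 \<and> B2 \<and> D) \<and> Y \<and> T"
    for P X1 X2 A1 A2 B1 B2 Y D T
    by blast
  show ?thesis
    unfolding st2_hybrid_def all_less_double_Suc all_from_double[OF assms(1)]
      st2_pointer_swap_block k_Suc k_def[symmetric] all_from_Suc[OF k] t' swap
    by (rule taut[OF step])
qed

text \<open>Swapping is precomposition with a transposition of the index range, which only reorders
  the factors. This makes the two preimages of a block equally likely.\<close>

lemma prod_swap_block: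
  fixes f :: "'a \<Rightarrow> real"
  assumes "N < L"
  shows "(\<Prod>i<2 * L. f (swap_block N c i)) = (\<Prod>i<2 * L. f (c i))"
proof -
  let ?\<pi> = "Transposition.transpose (2 * N) (2 * N + 1)"
  have "bij_betw ?\<pi> {..<2 * L} {..<2 * L}"
    using assms by (auto intro!: permutes_imp_bij permutes_swap_id)
  moreover have "swap_block N c i = c (?\<pi> i)" for i
    by (auto simp: swap_block_def Transposition.transpose_def)
  ultimately show ?thesis
    by (simp add: prod.reindex_bij_betw[where g = "\<lambda>i. f (c i)"])
qed

section \<open>I.i.d. sequences of discrete random variables\<close>

lemma (in prob_space) iid_seq_measurable:
  "iid_seq M p X \<Longrightarrow> X n \<in> M \<rightarrow>\<^sub>M count_space UNIV"
  by (simp add: iid_seq_def indep_vars_def2)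

lemma (in prob_space) iid_seq_prob_eq:
  assumes "iid_seq M p X"
  shows "prob {\<omega>\<in>space M. X n \<omega> = a} = pmf p a"
proof -
  have "prob {\<omega>\<in>space M. X n \<omega> = a} = measure (distr M (count_space UNIV) (X n)) {a}"
    using iid_seq_measurable[OF assms]
    by (subst measure_distr) (auto intro!: arg_cong[where f = prob])
  also have "\<dots> = pmf p a"
    using assms by (simp add: iid_seq_def measure_pmf_single)
  finally show ?thesis .
qed

lemma (in prob_space) iid_seq_prob_all:
  assumes X: "iid_seq M p X" and "finite J"
  shows "prob {\<omega>\<in>space M. \<forall>i\<in>J. X i \<omega> = c i} = (\<Prod>i\<in>J. pmf p (c i))"
proof (cases "J = {}")
  \<comment> \<open>An empty intersection would be \<open>UNIV\<close> instead of
    \<open>space M\<close>, hence the separate case.\<close>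
  case False
  have "{\<omega>\<in>space M. \<forall>i\<in>J. X i \<omega> = c i} = (\<Inter>i\<in>J. X i -` {c i} \<inter> space M)"
    using False by auto
  also have "prob \<dots> = (\<Prod>i\<in>J. prob (X i -` {c i} \<inter> space M))"
    using X False \<open>finite J\<close> by (intro indep_varsD) (auto simp: iid_seq_def)
  also have "\<dots> = (\<Prod>i\<in>J. pmf p (c i))"
    using iid_seq_prob_eq[OF X] by (simp add: vimage_def Int_def conj_commute)
  finally show ?thesis .
qed (simp add: prob_space)

text \<open>Every finite index set lies in a prefix of even length, and over a countable alphabet
  the law of a prefix is determined by its point probabilities. Hence \<open>Z\<close> and
  \<open>X\<close> have the same finite-dimensional laws, and independence and marginals carry
  over.\<close>

lemma (in prob_space) iid_seq_transfer:
  fixes X Z :: "nat \<Rightarrow> 'a \<Rightarrow> 'b::countable"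
  assumes X: "iid_seq M p X"
    and Z: "\<And>n. Z n \<in> M \<rightarrow>\<^sub>M count_space UNIV"
    and eq: "\<And>L c. prob {\<omega>\<in>space M. \<forall>i<2 * L. Z i \<omega> = c i} = (\<Prod>i<2 * L. pmf p (c i))"
  shows "iid_seq M p Z"
proof -
  note X_meas = iid_seq_measurable[OF X]
  \<comment> \<open>Lists over a countable type again form a countable type, so their laws can be
    compared on singletons.\<close>
  define lst where "lst = (\<lambda>W L (\<omega>::'a). map (\<lambda>i. W i \<omega> :: 'b) [0..<2 * L])"
  have lst_vimage: "lst W L -` {l} \<inter> space M =
      (if length l = 2 * L then {\<omega>\<in>space M. \<forall>i<2 * L. W i \<omega> = l ! i} else {})" for W L l
    by (auto simp: lst_def list_eq_iff_nth_eq)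
  have lst_meas: "lst W L \<in> M \<rightarrow>\<^sub>M count_space UNIV"
    if [measurable]: "\<And>n. W n \<in> M \<rightarrow>\<^sub>M count_space UNIV" for W L
    unfolding measurable_count_space_eq2_countable lst_vimage by auto
  have distr_eq: "distr M (count_space UNIV) (lst Z L) = distr M (count_space UNIV) (lst X L)"
    for L
  proof (rule measure_eqI_countable[of _ UNIV])
    fix l :: "'b list"
    have "prob {\<omega>\<in>space M. \<forall>i<2 * L. X i \<omega> = l ! i} = (\<Prod>i<2 * L. pmf p (l ! i))"
      using iid_seq_prob_all[OF X, of "{..<2 * L}"] by (simp add: Ball_def)
    then have "prob (lst Z L -` {l} \<inter> space M) = prob (lst X L -` {l} \<inter> space M)"
      unfolding lst_vimage using eq by auto
    then show "emeasure (distr M (count_space UNIV) (lst Z L)) {l} =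
        emeasure (distr M (count_space UNIV) (lst X L)) {l}"
      by (simp add: emeasure_distr lst_meas X_meas Z emeasure_eq_measure)
  qed auto
  \<comment> \<open>The event is the preimage under \<open>lst\<close> of a set of lists; equal laws
    of the prefixes pass from point probabilities to arbitrary sets \<open>A i\<close>.\<close>
  have transfer: "prob {\<omega>\<in>space M. \<forall>i\<in>J. Z i \<omega> \<in> A i} = prob {\<omega>\<in>space M. \<forall>i\<in>J. X i \<omega> \<in> A i}"
    if "finite J" for J A
  proof -
    from that obtain L where "\<forall>i\<in>J. i < L"
      unfolding finite_nat_set_iff_bounded ..
    then have L: "i < 2 * L" if "i \<in> J" for i
      using that by fastforce
    define S where "S = {l. \<forall>i\<in>J. l ! i \<in> A i}"
    have "lst W L -` S \<inter> space M = {\<omega>\<in>space M. \<forall>i\<in>J. W i \<omega> \<in> A i}" for W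
      by (auto simp: S_def lst_def L)
    then have *: "measure (distr M (count_space UNIV) (lst W L)) S =
        prob {\<omega>\<in>space M. \<forall>i\<in>J. W i \<omega> \<in> A i}"
      if "\<And>n. W n \<in> M \<rightarrow>\<^sub>M count_space UNIV" for W
      by (simp add: measure_distr[OF lst_meas[OF that]])
    show ?thesis
      using *[of X, OF X_meas] *[of Z, OF Z] by (simp only: distr_eq)
  qed
  have transfer1: "prob (Z n -` A \<inter> space M) = prob (X n -` A \<inter> space M)" for n A
    using transfer[of "{n}" "\<lambda>_. A"] by (simp add: vimage_def Int_def conj_commute)
  show ?thesis
    unfolding iid_seq_def
  proof (intro conjI allI)
    show "indep_vars (\<lambda>_. count_space UNIV) Z UNIV"
      unfolding indep_vars_def2
    proof (intro conjI ballI indep_setsI)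
      fix B J assume J: "J \<noteq> {}" "finite J"
        and "\<forall>j\<in>J. B j \<in> {Z j -` A \<inter> space M |A. A \<in> sets (count_space UNIV)}"
      then have "\<forall>j\<in>J. \<exists>A. B j = Z j -` A \<inter> space M"
        by auto
      from bchoice[OF this] obtain A where B: "\<forall>j\<in>J. B j = Z j -` A j \<inter> space M" ..
      have Int_eq: "(\<Inter>j\<in>J. W j -` A j \<inter> space M) = {\<omega>\<in>space M. \<forall>i\<in>J. W i \<omega> \<in> A i}"
        for W :: "nat \<Rightarrow> 'a \<Rightarrow> 'b"
        using J by auto
      have "(\<Inter>j\<in>J. B j) = (\<Inter>j\<in>J. Z j -` A j \<inter> space M)"
        using B by auto
      also have "prob \<dots> = prob (\<Inter>j\<in>J. X j -` A j \<inter> space M)"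
        by (simp only: Int_eq transfer[OF \<open>finite J\<close>])
      also have "\<dots> = (\<Prod>j\<in>J. prob (X j -` A j \<inter> space M))"
        using X J by (intro indep_varsD) (auto simp: iid_seq_def)
      finally show "prob (\<Inter>j\<in>J. B j) = (\<Prod>j\<in>J. prob (B j))"
        by (simp add: B transfer1)
    qed (use Z in \<open>auto intro: measurable_sets\<close>)
  next
    fix n
    have "distr M (count_space UNIV) (Z n) = distr M (count_space UNIV) (X n)"
      by (rule measure_eqI) (simp_all add: emeasure_distr Z X_meas emeasure_eq_measure transfer1)
    then show "distr M (count_space UNIV) (Z n) = measure_pmf p"
      using X by (simp add: iid_seq_def)
  qed
qed

text \<open>The collision event is the disjoint union over all letters \<open>a\<close> of the
  events that both variables equal \<open>a\<close>; independence gives each a squared probability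
  and countable additivity sums them.\<close>

lemma (in prob_space) iid_seq_prob_collision:
  fixes X :: "nat \<Rightarrow> 'a \<Rightarrow> 'b::countable"
  assumes X: "iid_seq M p X" and "m \<noteq> n"
  shows "prob {\<omega>\<in>space M. X m \<omega> = X n \<omega>} = (\<Sum>\<^sub>\<infinity>a. (pmf p a)\<^sup>2)"
proof -
  note [measurable] = iid_seq_measurable[OF X]
  define E where "E a = {\<omega>\<in>space M. X m \<omega> = a \<and> X n \<omega> = a}" for a
  have prob_E: "prob (E a) = (pmf p a)\<^sup>2" for a
    using iid_seq_prob_all[OF X, of "{m, n}" "\<lambda>_. a"] \<open>m \<noteq> n\<close>
    by (simp add: E_def power2_eq_square)
  \<comment> \<open>The squares are dominated by the summable probabilities themselves, which are at
    most 1.\<close>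
  have summable: "Infinite_Set_Sum.abs_summable_on (\<lambda>a. (pmf p a)\<^sup>2) UNIV"
    by (rule abs_summable_on_comparison_test'[OF pmf_abs_summable[of p]])
      (simp add: power2_eq_square mult_left_le pmf_le_1)
  have "{\<omega>\<in>space M. X m \<omega> = X n \<omega>} = (\<Union>a. E a)"
    by (auto simp: E_def)
  also have "emeasure M \<dots> = (\<integral>\<^sup>+a. emeasure M (E a) \<partial>count_space UNIV)"
    by (rule emeasure_UN_countable) (auto simp: E_def disjoint_family_on_def)
  also have "\<dots> = ennreal (infsetsum (\<lambda>a. (pmf p a)\<^sup>2) UNIV)"
    using nn_integral_conv_infsetsum[OF summable] by (simp add: emeasure_eq_measure prob_E)
  finally have "prob {\<omega>\<in>space M. X m \<omega> = X n \<omega>} = infsetsum (\<lambda>a. (pmf p a)\<^sup>2) UNIV"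
    by (simp add: emeasure_eq_measure infsetsum_nonneg)
  then show ?thesis
    by (simp add: infsetsum_infsum[OF summable])
qed

lemma cylinder_in_seq_sets:
  fixes W :: "nat \<Rightarrow> 'w \<Rightarrow> 'd"
  shows "{\<omega>\<in>space M. \<forall>i<n. W i \<omega> = d i} \<in> seq_sets M W"
proof -
  have "{f \<in> space (PiM UNIV (\<lambda>_::nat. count_space (UNIV :: 'd set))). \<forall>i<n. f i = d i}
      \<in> sets (PiM UNIV (\<lambda>_. count_space UNIV))"
    by measurable
  then have "(\<lambda>\<omega> i. W i \<omega>) -` {f. \<forall>i<n. f i = d i} \<inter> space M \<in> seq_sets M W"
    unfolding seq_sets_def by (intro CollectI exI[of _ "{f. \<forall>i<n. f i = d i}"])
      (simp add: space_PiM)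
  then show ?thesis
    by (simp add: vimage_def Int_def conj_commute)
qed

text \<open>Prefix events are cylinders, hence generated by the whole sequences, and independence of
  the sequences applies to them.\<close>

lemma (in prob_space) indep_seqs_prob:
  assumes "indep_seqs M X Y"
  shows "prob {\<omega>\<in>space M. (\<forall>i<m. X i \<omega> = c i) \<and> (\<forall>i<n. Y i \<omega> = t i)} =
    prob {\<omega>\<in>space M. \<forall>i<m. X i \<omega> = c i} * prob {\<omega>\<in>space M. \<forall>i<n. Y i \<omega> = t i}"
proof -
  have "{\<omega>\<in>space M. (\<forall>i<m. X i \<omega> = c i) \<and> (\<forall>i<n. Y i \<omega> = t i)} =
      {\<omega>\<in>space M. \<forall>i<m. X i \<omega> = c i} \<inter> {\<omega>\<in>space M. \<forall>i<n. Y i \<omega> = t i}"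
    by auto
  then show ?thesis
    using indep_setD[OF assms[unfolded indep_seqs_def] cylinder_in_seq_sets cylinder_in_seq_sets]
    by simp
qed

section \<open>The law of the output\<close>

lemma measurable_st2_pointer:
  fixes x :: "nat \<Rightarrow> 'w \<Rightarrow> 'a::countable"
  assumes [measurable]: "\<And>n. x n \<in> M \<rightarrow>\<^sub>M count_space UNIV"
  shows "(\<lambda>\<omega>. st2_pointer (\<lambda>i. x i \<omega>) j) \<in> M \<rightarrow>\<^sub>M count_space UNIV"
  by (induction j) (simp_all add: block_def)

lemma measurable_St2:
  fixes x :: "nat \<Rightarrow> 'w \<Rightarrow> 'a::{countable,linorder}"
  assumes [measurable]: "\<And>n. x n \<in> M \<rightarrow>\<^sub>M count_space UNIV"
    and [measurable]: "\<And>n. y n \<in> M \<rightarrow>\<^sub>M count_space UNIV"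
  shows "(\<lambda>\<omega>. St2 (\<lambda>i. x i \<omega>) (\<lambda>i. y i \<omega>) n) \<in> M \<rightarrow>\<^sub>M count_space UNIV"
proof -
  note [measurable] = measurable_st2_pointer[of x M, OF assms(1)]
  define f where "f u v s = (if even n then fst (st2_block (u, v) s) else snd (st2_block (u, v) s))"
    for u v :: 'a and s
  \<comment> \<open>The hidden symbol is read at a random index. The pointer has countably many
    values, so the index can be frozen; the two letters are frozen in the same way below.\<close>
  have y: "(\<lambda>\<omega>. y (st2_pointer (\<lambda>i. x i \<omega>) (n div 2)) \<omega>) \<in> M \<rightarrow>\<^sub>M count_space UNIV"
    by (rule measurable_compose_countable[where f = y]) measurable
  have "(\<lambda>\<omega>. f u v (y (st2_pointer (\<lambda>i. x i \<omega>) (n div 2)) \<omega>)) \<in> M \<rightarrow>\<^sub>M count_space UNIV" for u v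
    by (rule measurable_compose[OF y]) simp
  then have "(\<lambda>\<omega>. f u (x (2 * (n div 2) + 1) \<omega>) (y (st2_pointer (\<lambda>i. x i \<omega>) (n div 2)) \<omega>))
      \<in> M \<rightarrow>\<^sub>M count_space UNIV" for u
    by (rule measurable_compose_countable) (rule assms)
  then have "(\<lambda>\<omega>. f (x (2 * (n div 2)) \<omega>) (x (2 * (n div 2) + 1) \<omega>)
      (y (st2_pointer (\<lambda>i. x i \<omega>) (n div 2)) \<omega>)) \<in> M \<rightarrow>\<^sub>M count_space UNIV"
    by (rule measurable_compose_countable) (rule assms)
  then show ?thesis
    by (simp only: f_def St2_def block_def Let_def)
qed

text \<open>Induction on \<open>N\<close>, from independence of the prescribed prefixes at
  \<open>N = 0\<close>. Both \<open>c\<close> and \<open>t\<close> vary because a block of distinct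
  letters calls the hypothesis for the swapped \<open>c\<close> and an altered \<open>t\<close>. The
  exponent counts the hidden bits still prescribed.\<close>

lemma (in prob_space) prob_st2_hybrid:
  fixes x :: "nat \<Rightarrow> 'a \<Rightarrow> 'b::{countable,linorder}"
  assumes x: "iid_seq M p x" and y: "iid_seq M (pmf_of_set {0, 1}) y"
    and indep: "indep_seqs M x y"
    and "N \<le> L" and "st2_pointer c N \<le> K"
  shows "prob {\<omega>\<in>space M. st2_hybrid (\<lambda>i. x i \<omega>) (\<lambda>i. y i \<omega>) L K c t N} =
    (\<Prod>i<2 * L. pmf p (c i)) * (1 / 2) ^ (K - st2_pointer c N)"
  using assms(4,5)
proof (induction N arbitrary: c t)
  case 0
  have "pmf (pmf_of_set {0, 1}) s = 1 / 2" for s :: bit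
    by (cases s) simp_all
  moreover have "prob {\<omega>\<in>space M. \<forall>i<2 * L. x i \<omega> = c i} = (\<Prod>i<2 * L. pmf p (c i))"
    using iid_seq_prob_all[OF x, of "{..<2 * L}" c] by (simp add: Ball_def)
  moreover have "prob {\<omega>\<in>space M. \<forall>i<K. y i \<omega> = t i} = (\<Prod>i<K. pmf (pmf_of_set {0, 1}) (t i))"
    using iid_seq_prob_all[OF y, of "{..<K}" t] by (simp add: Ball_def)
  ultimately show ?case
    using indep_seqs_prob[OF indep, of "2 * L" c K t] by (simp add: st2_hybrid_def)
next
  case (Suc N)
  note [measurable] = iid_seq_measurable[OF x] iid_seq_measurable[OF y]
  note [measurable] = measurable_St2[of x M y, OF iid_seq_measurable[OF x] iid_seq_measurable[OF y]]
  have N: "N < L" "N \<le> L" using Suc.prems by auto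
  let ?k = "st2_pointer c N"
  let ?H = "\<lambda>c t N \<omega>. st2_hybrid (\<lambda>i. x i \<omega>) (\<lambda>i. y i \<omega>) L K c t N"
  have H_meas: "{\<omega>\<in>space M. ?H c t N \<omega>} \<in> events" for c t
    unfolding st2_hybrid_def by measurable
  show ?case
  proof (cases "c (2 * N) = c (2 * N + 1)")
    case True
    then have "st2_pointer c (Suc N) = ?k"
      by (simp add: block_def)
    then show ?thesis
      using Suc.IH[of c t] Suc.prems N by (simp add: st2_hybrid_Suc_eq[OF N(1) True])
  next
    case False
    then have k: "st2_pointer c (Suc N) = Suc ?k"
      by (simp add: block_def)
    define t' where "t' = t(?k := if c (2 * N) < c (2 * N + 1) then 0 else 1)"
    let ?c' = "swap_block N c"
    have "{\<omega>\<in>space M. ?H c t (Suc N) \<omega>} = {\<omega>\<in>space M. ?H c t' N \<omega>} \<union> {\<omega>\<in>space M. ?H ?c' t' N \<omega>}"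
      using st2_hybrid_Suc_neq[OF N(1) False Suc.prems(2)] by (auto simp: t'_def)
    \<comment> \<open>The two events prescribe different letters at position \<open>2 * N\<close> of
      the covertext.\<close>
    moreover have "{\<omega>\<in>space M. ?H c t' N \<omega>} \<inter> {\<omega>\<in>space M. ?H ?c' t' N \<omega>} = {}"
      using False by (auto simp: st2_hybrid_def all_from_double[OF N(1)] swap_block_def)
    ultimately have "prob {\<omega>\<in>space M. ?H c t (Suc N) \<omega>} =
        prob {\<omega>\<in>space M. ?H c t' N \<omega>} + prob {\<omega>\<in>space M. ?H ?c' t' N \<omega>}"
      by (simp add: finite_measure_Union H_meas)
    also have "\<dots> = (\<Prod>i<2 * L. pmf p (c i)) * (2 * (1 / 2) ^ (K - ?k))"
      using Suc.IH[OF N(2), of c t'] Suc.IH[OF N(2), of ?c' t'] Suc.prems(2) k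
        prod_swap_block[OF N(1), of "pmf p" c]
      by (simp add: st2_pointer_swap_block)
    \<comment> \<open>The extra factor 1/2 from the bit at position \<open>?k\<close> cancels the
      factor 2 from the two preimages.\<close>
    also have "K - ?k = Suc (K - Suc ?k)"
      using Suc.prems(2) k by simp
    finally show ?thesis
      by (simp only: k power_Suc)
  qed
qed

theorem theorem1:
  fixes M :: "'w measure"
    and \<mu> :: "'a::{countable,linorder} pmf"
    and x :: "nat \<Rightarrow> 'w \<Rightarrow> 'a"
    and y :: "nat \<Rightarrow> 'w \<Rightarrow> bit"
  assumes "prob_space M"
    and "\<exists>a b :: 'a. a \<noteq> b"
    and "iid_seq M \<mu> x"
    and "iid_seq M (pmf_of_set {0, 1}) y"
    and "indep_seqs M x y"
  shows "iid_seq M \<mu> (\<lambda>n \<omega>. St2 (\<lambda>i. x i \<omega>) (\<lambda>i. y i \<omega>) n) \<and>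
    (\<forall>j. hidden_rate M x j = 1 / 2 * (1 - (\<Sum>\<^sub>\<infinity>a. (pmf \<mu> a)\<^sup>2)))"
proof (intro conjI allI)
  interpret prob_space M by fact
  note x = assms(3) and y = assms(4)
  note meas [measurable] = iid_seq_measurable[OF x] iid_seq_measurable[OF y]
  show "iid_seq M \<mu> (\<lambda>n \<omega>. St2 (\<lambda>i. x i \<omega>) (\<lambda>i. y i \<omega>) n)"
  proof (rule iid_seq_transfer[OF x])
    fix L and c :: "nat \<Rightarrow> 'a"
    show "prob {\<omega>\<in>space M. \<forall>i<2 * L. St2 (\<lambda>i. x i \<omega>) (\<lambda>i. y i \<omega>) i = c i} =
        (\<Prod>i<2 * L. pmf \<mu> (c i))"
      \<comment> \<open>With \<open>N = L\<close> and \<open>K = st2_pointer c L\<close> the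
        constraints on covertext and hidden text are vacuous and the exponent is 0.\<close>
      using prob_st2_hybrid[OF x y assms(5) order_refl order_refl, of L c]
      by (simp add: st2_hybrid_def linorder_not_le)
  qed (rule measurable_St2[OF meas])
  fix j
  let ?E = "{\<omega>\<in>space M. x (2 * j) \<omega> = x (2 * j + 1) \<omega>}"
  \<comment> \<open>A block uses one symbol exactly when its letters differ, so the expectation is
    the probability of no collision.\<close>
  have "(\<integral>\<omega>. real (st2_used (block (\<lambda>n. x n \<omega>) j)) \<partial>M) = (\<integral>\<omega>. indicator (space M - ?E) \<omega> \<partial>M)"
    by (rule Bochner_Integration.integral_cong) (auto simp: block_def)
  also have "\<dots> = prob (space M - ?E)"
    by simp
  also have "\<dots> = 1 - prob ?E"
    by (rule prob_compl) measurable
  also have "prob ?E = (\<Sum>\<^sub>\<infinity>a. (pmf \<mu> a)\<^sup>2)"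
    by (rule iid_seq_prob_collision[OF x]) simp
  finally show "hidden_rate M x j = 1 / 2 * (1 - (\<Sum>\<^sub>\<infinity>a. (pmf \<mu> a)\<^sup>2))"
    by (simp add: hidden_rate_def)
qed

end
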